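(* Let $X_0=\sigma u v^\top\in\mathbb{R}^{m\times n}$ with $\sigma>0$, $\|u\|=\|v\|=1$, and suppose all entries are observed without noise, i.e. $\Omega=[m]\times[n]$ and $X=X_0$. Let $(u_1,v_1)\in\mathbb{R}^m\times\mathbb{R}^n$ be unit vectors with $\alpha_1=u^\top u_1>0$ and $\beta_1=v^\top v_1>0$, and let $(u_t,v_t)_{t\ge 1}$ be the sequence of estimates generated by \texttt{R2RILS} (with rank $r=1$) from the initial guess $(u_1,v_1)$. Put $\alpha_t=u^\top u_t$, $\beta_t=v^\top v_t$, $\epsilon_t=\sqrt{1-\alpha_t^2}$, $\delta_t=\sqrt{1-\beta_t^2}$. Then $(u_t,v_t)$ converges to $(u,v)$ linearly with a contraction factor smaller than $\sqrt{1-\frac{1}{\sqrt 2}}\approx 0.54$. Specifically, for every $t\ge 1$ with $(\epsilon_t,\delta_t)\neq(0,0)$, $$\left\| \begin{pmatrix} u_{t+1} \\ v_{t+1} \end{pmatrix} - \begin{pmatrix} u \\ v \end{pmatrix} \right\| = R(\epsilon_t, \delta_t) \left\| \begin{pmatrix} u_t \\ v_t \end{pmatrix} - \begin{pmatrix} u \\ v \end{pmatrix} \right\|,$$ where $$R(\epsilon_t, \delta_t) = \left[\frac{2 - r(\epsilon_t) - r(\delta_t)}{2 - \sqrt{1-\epsilon_t^2} - \sqrt{1-\delta_t^2}}\right]^{1/2} \leq \sqrt{1-\frac{1}{\sqrt{2}}}\, \max\{\epsilon_t, \delta_t\},$$ with $$h(\epsilon) = \sqrt{1+2\epsilon^2-3\epsilon^4},\qquad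 r(\epsilon) = \frac{1+\epsilon^2+h(\epsilon)}{\sqrt{2(1+3\epsilon^2+h(\epsilon))}}.$$
   Context: $\|\cdot\|$ is the Euclidean norm. The \texttt{R2RILS} algorithm in the rank-1 case with all entries of an $m\times n$ matrix $X$ observed: given unit vectors $(u_t,v_t)\in\mathbb{R}^m\times\mathbb{R}^n$, Step I: let $(\tilde u_t,\tilde v_t)$ be the minimizer of $\|u_t b^\top + a v_t^\top - X\|_F$ over $(a,b)\in\mathbb{R}^m\times\mathbb{R}^n$ having the smallest Euclidean norm $\sqrt{\|a\|^2+\|b\|^2}$ among all minimizers (it is unique). Step II: with $\mathrm{ColNorm}(x)=x/\|x\|$ for a nonzero vector $x$, set $u_{t+1}=\mathrm{ColNorm}(u_t+\mathrm{ColNorm}(\tilde u_t))$ and $v_{t+1}=\mathrm{ColNorm}(v_t+\mathrm{ColNorm}(\tilde v_t))$. *)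

theory Defs
  imports "HOL-Analysis.Analysis"
begin

definition outer :: "real ^ 'm \<Rightarrow> real ^ 'n \<Rightarrow> real ^ 'n ^ 'm"
  where "outer a b = (\<chi> i j. a $ i * b $ j)"

text \<open>The library norm on \<^typ>\<open>real ^ 'n ^ 'm\<close> is the Frobenius norm: it is the L2 norm of the
  vector of Euclidean norms of the rows.\<close>

definition ls_residual ::
    "real ^ 'n ^ 'm \<Rightarrow> real ^ 'm \<Rightarrow> real ^ 'n \<Rightarrow> (real ^ 'm) \<times> (real ^ 'n) \<Rightarrow> real"
  where "ls_residual X x y = (\<lambda>(a, b). norm (outer x b + outer a y - X))"

text \<open>The norm of a pair is the square root of the sum of the squared norms of its components. The
  minimizer of least norm is unique, so the choice inside \<^const>\<open>arg_min\<close> is immaterial.\<close>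

definition min_norm_ls ::
    "real ^ 'n ^ 'm \<Rightarrow> real ^ 'm \<Rightarrow> real ^ 'n \<Rightarrow> (real ^ 'm) \<times> (real ^ 'n)"
  where "min_norm_ls X x y = arg_min norm (is_arg_min (ls_residual X x y) (\<lambda>_. True))"

text \<open>The library function \<^const>\<open>sgn\<close> normalizes a nonzero vector to unit length, and
  maps the zero vector to itself.\<close>

abbreviation ColNorm :: "'a::real_normed_vector \<Rightarrow> 'a"
  where "ColNorm \<equiv> sgn"

definition r2rils_step ::
    "real ^ 'n ^ 'm \<Rightarrow> (real ^ 'm) \<times> (real ^ 'n) \<Rightarrow> (real ^ 'm) \<times> (real ^ 'n)"
  where "r2rils_step X = (\<lambda>(x, y). let (a, b) = min_norm_ls X x y
           in (ColNorm (x + ColNorm a), ColNorm (y + ColNorm b)))"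

definition h_fun :: "real \<Rightarrow> real"
  where "h_fun e = sqrt (1 + 2 * e\<^sup>2 - 3 * e ^ 4)"

definition r_fun :: "real \<Rightarrow> real"
  where "r_fun e = (1 + e\<^sup>2 + h_fun e) / sqrt (2 * (1 + 3 * e\<^sup>2 + h_fun e))"

definition R_fun :: "real \<Rightarrow> real \<Rightarrow> real"
  where "R_fun e d =
    sqrt ((2 - r_fun e - r_fun d) / (2 - sqrt (1 - e\<^sup>2) - sqrt (1 - d\<^sup>2)))"

end

theory Submission
  imports Defs
begin

text \<open>For unit vectors \<open>x, y\<close> with \<open>\<alpha> = u \<bullet> x\<close> and \<open>\<beta> = v \<bullet> y\<close>, the least squares minimizers form a line in
  direction \<open>(x, -y)\<close>, and the shortest one is \<open>(\<sigma>\<beta> (u - (\<alpha>/2) x), \<sigma>\<alpha> (v - (\<beta>/2) y))\<close>. Hence the two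
  factors decouple: the new overlap is \<open>p = r(\<epsilon>)\<close>, where \<open>\<epsilon>\<^sup>2 = 1 - \<alpha>\<^sup>2\<close>. Moreover
  \<open>p\<^sup>2 = (1 + q)/2\<close> with \<open>q = \<alpha> (3 - 2 \<alpha>\<^sup>2) / sqrt (4 - 3 \<alpha>\<^sup>2)\<close>, and \<open>1 - q\<^sup>2 = 4 \<epsilon>\<^sup>6 / (4 - 3 \<alpha>\<^sup>2)\<close>, so
  that \<open>(1 - p) (1 + p) p\<^sup>2 (4 - 3 \<alpha>\<^sup>2) = \<epsilon>\<^sup>6\<close>. Since \<open>q \<ge> \<alpha>\<close>, this bounds the new squared error
  \<open>2 (1 - p)\<close> by \<open>(1 - 1/sqrt 2) \<epsilon>\<^sup>2\<close> times the old one \<open>2 (1 - \<alpha>)\<close>.\<close>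

section \<open>Outer products and the least squares problem\<close>

lemma inner_outer_outer: "outer a b \<bullet> outer c d = (a \<bullet> c) * (b \<bullet> d)"
  by (simp add: outer_def inner_vec_def sum_product mult_ac) (rule sum.swap)

lemma outer_add_left: "outer (a + b) c = outer a c + outer b c"
  by (simp add: outer_def vec_eq_iff algebra_simps)

lemma outer_add_right: "outer a (b + c) = outer a b + outer a c"
  by (simp add: outer_def vec_eq_iff algebra_simps)

text \<open>The kernel of the linear map behind the least squares problem: two minimizers can differ
  only by a multiple of \<open>(x, -y)\<close>. Pairing the equation with \<open>outer c d\<close>
  gives a scalar identity, which is tested at \<open>(x, y)\<close>, \<open>(c, y)\<close> and
  \<open>(x, d)\<close>.\<close>

lemma outer_sum_eq_0D:
  assumes "norm x = 1" "norm y = 1" and 0: "outer x q + outer p y = 0"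
  shows "p = (p \<bullet> x) *\<^sub>R x" "q = - (p \<bullet> x) *\<^sub>R y"
proof -
  have xy: "x \<bullet> x = 1" "y \<bullet> y = 1"
    using assms(1,2) by (simp_all add: dot_square_norm)
  have *: "(x \<bullet> c) * (q \<bullet> d) + (p \<bullet> c) * (y \<bullet> d) = 0" for c d
    using arg_cong[OF 0, of "\<lambda>M. M \<bullet> outer c d"] by (simp add: inner_add_left inner_outer_outer)
  have qy: "q \<bullet> y = - (p \<bullet> x)"
    using *[of x y] xy by simp
  have "p \<bullet> c = ((p \<bullet> x) *\<^sub>R x) \<bullet> c" for c
    using *[of c y] xy qy by (simp add: algebra_simps)
  then show "p = (p \<bullet> x) *\<^sub>R x"
    using vector_eq_rdot by blast
  have "q \<bullet> d = (- (p \<bullet> x) *\<^sub>R y) \<bullet> d" for d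
    using *[of x d] xy by (simp add: algebra_simps)
  then show "q = - (p \<bullet> x) *\<^sub>R y"
    using vector_eq_rdot by blast
qed

text \<open>Pythagoras is used twice. The residual matrix at the claimed pair is orthogonal to the
  range of the linear map, so the pair is a minimizer; the pair itself is orthogonal to the kernel,
  so every other minimizer is strictly longer.\<close>

lemma min_norm_ls_outer:
  fixes x u :: "real ^ 'm" and y v :: "real ^ 'n"
  assumes x: "norm x = 1" and y: "norm y = 1"
  shows "min_norm_ls (\<sigma> *\<^sub>R outer u v) x y =
    ((\<sigma> * (v \<bullet> y)) *\<^sub>R (u - ((u \<bullet> x) / 2) *\<^sub>R x), (\<sigma> * (u \<bullet> x)) *\<^sub>R (v - ((v \<bullet> y) / 2) *\<^sub>R y))"
proof -
  define X where "X = \<sigma> *\<^sub>R outer u v"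
  define a where "a = (\<sigma> * (v \<bullet> y)) *\<^sub>R (u - ((u \<bullet> x) / 2) *\<^sub>R x)"
  define b where "b = (\<sigma> * (u \<bullet> x)) *\<^sub>R (v - ((v \<bullet> y) / 2) *\<^sub>R y)"
  define E where "E = outer x b + outer a y - X"
  have xy: "x \<bullet> x = 1" "y \<bullet> y = 1"
    using x y by (simp_all add: dot_square_norm)
  have "E \<bullet> outer x q = 0" for q
    by (simp add: E_def X_def inner_add_left inner_diff_left inner_outer_outer a_def b_def xy
        algebra_simps inner_commute)
  moreover have "E \<bullet> outer p y = 0" for p
    by (simp add: E_def X_def inner_add_left inner_diff_left inner_outer_outer a_def b_def xy
        algebra_simps inner_commute)
  ultimately have orth: "E \<bullet> (outer x q + outer p y) = 0" for p q
    by (simp add: inner_add_right)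
  have pyth: "(ls_residual X x y (a + p, b + q))\<^sup>2 = (norm E)\<^sup>2 + (norm (outer x q + outer p y))\<^sup>2" for p q
  proof -
    have "outer x (b + q) + outer (a + p) y - X = E + (outer x q + outer p y)"
      by (simp add: E_def outer_add_left outer_add_right)
    then show ?thesis
      using norm_add_Pythagorean[of E "outer x q + outer p y"] orth[of q p]
      by (simp add: ls_residual_def orthogonal_def)
  qed
  have E: "ls_residual X x y (a, b) = norm E"
    by (simp add: ls_residual_def E_def)
  have nonneg: "ls_residual X x y z \<ge> 0" for z
    by (simp add: ls_residual_def split: prod.split)
  have le: "norm E \<le> ls_residual X x y z" for z
  proof (rule power2_le_imp_le)
    have "(norm E)\<^sup>2 \<le> (ls_residual X x y (a + (fst z - a), b + (snd z - b)))\<^sup>2"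
      unfolding pyth by simp
    then show "(norm E)\<^sup>2 \<le> (ls_residual X x y z)\<^sup>2"
      by simp
  qed (rule nonneg)
  have min: "is_arg_min (ls_residual X x y) (\<lambda>_. True) (a, b)"
    using le by (auto simp: is_arg_min_def E not_less)
  have dist: "(norm z)\<^sup>2 = (norm (a, b))\<^sup>2 + (norm (z - (a, b)))\<^sup>2"
    if z: "is_arg_min (ls_residual X x y) (\<lambda>_. True) z" for z
  proof -
    define p q where "p = fst z - a" and "q = snd z - b"
    have z_eq: "z = (a + p, b + q)"
      by (simp add: p_def q_def)
    have "ls_residual X x y z = norm E"
      using z le[of z] E by (metis antisym is_arg_min_def not_less)
    with pyth[of p q] have "outer x q + outer p y = 0"
      by (simp add: z_eq)
    from outer_sum_eq_0D[OF x y this] obtain c where pq: "p = c *\<^sub>R x" "q = - c *\<^sub>R y"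
      by blast
    \<comment> \<open>Both sides are half of
      \<open>\<sigma> * (u \<bullet> x) * (v \<bullet> y)\<close>. The halves in \<open>a\<close>
      and \<open>b\<close> serve this balance, which is orthogonality to the kernel direction
      \<open>(x, -y)\<close>.\<close>
    have ax: "a \<bullet> x = b \<bullet> y"
      by (simp add: a_def b_def xy algebra_simps)
    have "(a, b) \<bullet> (p, q) = c * (a \<bullet> x - b \<bullet> y)"
      by (simp add: pq algebra_simps)
    then have "orthogonal (a, b) (p, q)"
      by (simp add: ax orthogonal_def)
    from norm_add_Pythagorean[OF this] show ?thesis
      by (simp add: z_eq)
  qed
  have "arg_min norm (is_arg_min (ls_residual X x y) (\<lambda>_. True)) = (a, b)"
    unfolding arg_min_def
  proof (rule some_equality)
    have "norm (a, b) \<le> norm z" if "is_arg_min (ls_residual X x y) (\<lambda>_. True) z" for z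
    proof (rule power2_le_imp_le)
      show "(norm (a, b))\<^sup>2 \<le> (norm z)\<^sup>2"
        unfolding dist[OF that] by simp
    qed simp
    with min show "is_arg_min norm (is_arg_min (ls_residual X x y) (\<lambda>_. True)) (a, b)"
      by (auto simp: is_arg_min_def[of norm] not_less)
  next
    fix z assume "is_arg_min norm (is_arg_min (ls_residual X x y) (\<lambda>_. True)) z"
    then have z: "is_arg_min (ls_residual X x y) (\<lambda>_. True) z" and "norm z \<le> norm (a, b)"
      using min unfolding is_arg_min_def[of norm] by (auto simp: not_less)
    then have "(norm z)\<^sup>2 \<le> (norm (a, b))\<^sup>2"
      by (intro power_mono) auto
    with dist[OF z] show "z = (a, b)"
      by simp
  qed
  then show ?thesis
    by (simp add: min_norm_ls_def a_def b_def X_def)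
qed

section \<open>The normalized update and its overlap\<close>

lemma sgn_scaleR_pos: "0 < c \<Longrightarrow> sgn (c *\<^sub>R w) = sgn w" for w :: "'a::real_normed_vector"
  by (simp add: sgn_scaleR)

text \<open>The scalars in front of the two least squares components are positive, so normalization
  removes them. Each factor then evolves without reference to the other or to
  \<open>\<sigma>\<close>.\<close>

lemma r2rils_step_outer:
  assumes "norm x = 1" "norm y = 1" "0 < \<sigma>" "0 < u \<bullet> x" "0 < v \<bullet> y"
  shows "r2rils_step (\<sigma> *\<^sub>R outer u v) (x, y) =
    (sgn (x + sgn (u - ((u \<bullet> x) / 2) *\<^sub>R x)), sgn (y + sgn (v - ((v \<bullet> y) / 2) *\<^sub>R y)))"
  using assms by (simp add: r2rils_step_def min_norm_ls_outer sgn_scaleR_pos)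

lemma inner_le_1: "norm w = 1 \<Longrightarrow> norm z = 1 \<Longrightarrow> w \<bullet> z \<le> 1" for w z :: "'a::real_inner"
  using norm_cauchy_schwarz[of w z] by simp

text \<open>The radicand of \<open>h_fun\<close> factors as
  \<open>(1 - e\<^sup>2) * (1 + 3 * e\<^sup>2)\<close>. In terms of the overlap \<open>s\<close> its
  root is \<open>s * sqrt (4 - 3 * s\<^sup>2)\<close>, and the last root reappears as a length in
  the update.\<close>

lemma r_fun_sqrt:
  assumes "0 < s" "s \<le> 1"
  shows "r_fun (sqrt (1 - s\<^sup>2)) =
    (2 - s\<^sup>2 + s * sqrt (4 - 3 * s\<^sup>2)) / sqrt (2 * (4 - 3 * s\<^sup>2 + s * sqrt (4 - 3 * s\<^sup>2)))"
proof -
  have s2: "s\<^sup>2 \<le> 1"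
    using assms by (simp add: power_le_one)
  define e where "e = sqrt (1 - s\<^sup>2)"
  have e2: "e\<^sup>2 = 1 - s\<^sup>2"
    using s2 by (simp add: e_def)
  have "e ^ 4 = (e\<^sup>2)\<^sup>2"
    by simp
  then have "1 + 2 * e\<^sup>2 - 3 * e ^ 4 = s\<^sup>2 * (4 - 3 * s\<^sup>2)"
    unfolding e2 by (simp add: power2_eq_square algebra_simps)
  then have "h_fun e = s * sqrt (4 - 3 * s\<^sup>2)"
    using assms by (simp add: h_fun_def real_sqrt_mult)
  moreover have "1 + e\<^sup>2 = 2 - s\<^sup>2" "1 + 3 * e\<^sup>2 = 4 - 3 * s\<^sup>2"
    by (simp_all add: e2)
  ultimately have "r_fun e = (2 - s\<^sup>2 + s * sqrt (4 - 3 * s\<^sup>2)) /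
      sqrt (2 * (4 - 3 * s\<^sup>2 + s * sqrt (4 - 3 * s\<^sup>2)))"
    by (simp only: r_fun_def)
  then show ?thesis
    by (simp only: e_def)
qed

text \<open>The update stays in the span of \<open>u\<close> and \<open>x\<close>, so the inner
  products of these two vectors determine it. The number \<open>k\<close> is twice the length of
  \<open>w\<close>.\<close>

lemma
  fixes u x :: "'a::real_inner"
  assumes u: "norm u = 1" and x: "norm x = 1" and pos: "0 < u \<bullet> x"
  defines "x' \<equiv> sgn (x + sgn (u - ((u \<bullet> x) / 2) *\<^sub>R x))"
  shows norm_update: "norm x' = 1"
    and inner_update: "u \<bullet> x' = r_fun (sqrt (1 - (u \<bullet> x)\<^sup>2))"
proof -
  define s where "s = u \<bullet> x"
  define w where "w = u - (s / 2) *\<^sub>R x"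
  define k where "k = sqrt (4 - 3 * s\<^sup>2)"
  have uu: "u \<bullet> u = 1" "x \<bullet> x = 1" "x \<bullet> u = s" "u \<bullet> x = s"
    using u x by (simp_all add: dot_square_norm s_def inner_commute)
  have s: "0 < s" "s \<le> 1"
    using pos inner_le_1[OF u x] by (simp_all add: s_def)
  have "s\<^sup>2 \<le> 1"
    using s by (simp add: power_le_one)
  then have k2: "k\<^sup>2 = 4 - 3 * s\<^sup>2" and k: "0 < k"
    by (simp_all add: k_def)
  have "w \<bullet> w = (k / 2)\<^sup>2"
    by (simp add: w_def inner_diff_left inner_diff_right uu power_divide k2)
       (simp add: power2_eq_square field_simps)
  then have nw: "norm w = k / 2"
    using k by (simp add: norm_eq_sqrt_inner)
  then have sw: "sgn w = (2 / k) *\<^sub>R w"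
    by (simp only: sgn_div_norm nw) simp
  define z where "z = x + sgn w"
  have "sgn w \<bullet> sgn w = 1"
    using nw k by (auto simp: dot_square_norm norm_sgn)
  moreover have "x \<bullet> sgn w = s / k"
    unfolding sw by (simp add: w_def inner_diff_right uu)
  ultimately have "z \<bullet> z = 2 * (k + s) / k"
    using k by (simp add: z_def inner_add_left inner_add_right uu inner_commute field_simps)
  \<comment> \<open>Expanding by \<open>k\<close> makes the root of the numerator the denominator in
    \<open>r_fun_sqrt\<close>.\<close>
  also have "\<dots> = 2 * (k\<^sup>2 + s * k) / k\<^sup>2"
    using k by (simp add: power2_eq_square field_simps)
  finally have nz: "norm z = sqrt (2 * (k\<^sup>2 + s * k)) / k"
    using k by (simp add: norm_eq_sqrt_inner real_sqrt_divide)
  have "0 < norm z"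
    unfolding nz using k s by (intro divide_pos_pos) (auto intro!: add_pos_pos mult_pos_pos)
  have x': "x' = sgn z"
    by (simp add: x'_def z_def w_def s_def)
  show "norm x' = 1"
    using \<open>0 < norm z\<close> by (auto simp: x' norm_sgn)
  have "u \<bullet> z = (2 - s\<^sup>2 + s * k) / k"
    using k unfolding z_def sw by (simp add: w_def inner_add_right inner_diff_right uu)
       (simp add: power2_eq_square field_simps)
  then have "u \<bullet> x' = (2 - s\<^sup>2 + s * k) / sqrt (2 * (k\<^sup>2 + s * k))"
    using k by (simp add: x' sgn_div_norm nz)
  then show "u \<bullet> x' = r_fun (sqrt (1 - (u \<bullet> x)\<^sup>2))"
    using s k by (simp add: r_fun_sqrt uu flip: k_def k2)
qed

section \<open>Contraction estimate for a single factor\<close>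

lemma
  fixes s :: real
  assumes s: "0 < s" "s \<le> 1"
  shows r_fun_pos: "0 < r_fun (sqrt (1 - s\<^sup>2))"
    and one_minus_r_fun_le:
      "1 - r_fun (sqrt (1 - s\<^sup>2)) \<le> (1 - 1 / sqrt 2) * (1 - s\<^sup>2) * (1 - s)"
proof -
  define p where "p = r_fun (sqrt (1 - s\<^sup>2))"
  define k where "k = sqrt (4 - 3 * s\<^sup>2)"
  define q where "q = s * (3 - 2 * s\<^sup>2) / k"
  have s2: "s\<^sup>2 \<le> 1"
    using s by (simp add: power_le_one)
  then have k2: "k\<^sup>2 = 4 - 3 * s\<^sup>2" and k: "0 < k"
    by (simp_all add: k_def)
  have p_eq: "p = (2 - s\<^sup>2 + s * k) / sqrt (2 * (k\<^sup>2 + s * k))"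
    using s k by (simp add: p_def r_fun_sqrt flip: k_def k2)
  have den: "0 < 2 * (k\<^sup>2 + s * k)"
    using s k by (simp add: add_pos_pos)
  have p: "0 < p"
    unfolding p_eq using s2 s k den by (intro divide_pos_pos) (auto intro: add_pos_pos)
  then show "0 < r_fun (sqrt (1 - s\<^sup>2))"
    by (simp add: p_def)
  \<comment> \<open>Reducing by \<open>k\<^sup>2 = 4 - 3 * s\<^sup>2\<close> exposes the factor
    \<open>k + s\<close>, which cancels against the denominator of \<open>p\<^sup>2\<close>.\<close>
  have "(2 - s\<^sup>2 + s * k)\<^sup>2 = (2 - s\<^sup>2)\<^sup>2 + 2 * (2 - s\<^sup>2) * s * k + s\<^sup>2 * k\<^sup>2"
    by (simp add: power2_eq_square algebra_simps)
  also have "\<dots> = k\<^sup>2 + k * (s + s * (3 - 2 * s\<^sup>2)) + s * (s * (3 - 2 * s\<^sup>2))"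
    unfolding k2 by (simp add: power2_eq_square algebra_simps)
  also have "\<dots> = (k + s) * (k + s * (3 - 2 * s\<^sup>2))"
    by (simp add: power2_eq_square algebra_simps)
  finally have num: "(2 - s\<^sup>2 + s * k)\<^sup>2 = (k + s) * (k + s * (3 - 2 * s\<^sup>2))" .
  have "p\<^sup>2 = ((k + s) * (k + s * (3 - 2 * s\<^sup>2))) / (2 * (k\<^sup>2 + s * k))"
    using den by (simp only: p_eq power_divide num real_sqrt_pow2 less_imp_le)
  also have "2 * (k\<^sup>2 + s * k) = 2 * k * (k + s)"
    by (simp add: power2_eq_square algebra_simps)
  also have "((k + s) * (k + s * (3 - 2 * s\<^sup>2))) / \<dots> = (k + s * (3 - 2 * s\<^sup>2)) / (2 * k)"
    using k s by simp
  finally have "p\<^sup>2 = (k + s * (3 - 2 * s\<^sup>2)) / (2 * k)" .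
  then have p2: "2 * p\<^sup>2 = 1 + q"
    using k s by (simp add: q_def field_simps)
  have q2: "q\<^sup>2 * (4 - 3 * s\<^sup>2) = s\<^sup>2 * (3 - 2 * s\<^sup>2)\<^sup>2"
    using k by (simp add: q_def power_divide power_mult_distrib flip: k2)
  have "k\<^sup>2 \<le> (3 - 2 * s\<^sup>2)\<^sup>2"
  proof -
    have "(3 - 2 * s\<^sup>2)\<^sup>2 - k\<^sup>2 = (1 - s\<^sup>2) * (5 - 4 * s\<^sup>2)"
      unfolding k2 by (simp add: power2_eq_square algebra_simps)
    also have "\<dots> \<ge> 0"
      using s2 by (intro mult_nonneg_nonneg) auto
    finally show ?thesis by simp
  qed
  then have "k \<le> 3 - 2 * s\<^sup>2"
    by (rule power2_le_imp_le) (use s2 in simp)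
  then have qs: "s \<le> q"
    using k s by (simp add: q_def pos_le_divide_eq)
  \<comment> \<open>From \<open>2 * p\<^sup>2 = 1 + q\<close> and \<open>q \<ge> s > 0\<close>; this
    is the origin of the constant \<open>1 / sqrt 2\<close>.\<close>
  have "(1 / sqrt 2)\<^sup>2 \<le> p\<^sup>2"
    using p2 qs s by (simp add: power_divide)
  then have pge: "1 / sqrt 2 \<le> p"
    by (rule power2_le_imp_le) (use p in simp)
  \<comment> \<open>The cofactor that makes \<open>1 - p\<close> polynomial in \<open>s\<close>: as
    \<open>2 - 2 * p\<^sup>2 = 1 - q\<close>, the product \<open>4 * ((1 - p) * D)\<close> is
    \<open>(1 - q\<^sup>2) * (4 - 3 * s\<^sup>2)\<close>, which is free of roots.\<close>
  define D where "D = (1 + p) * p\<^sup>2 * (4 - 3 * s\<^sup>2)"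
  have D: "0 < D"
    unfolding D_def using p s2 by (intro mult_pos_pos) auto
  have "4 * ((1 - p) * D) = (2 - 2 * p\<^sup>2) * (2 * p\<^sup>2) * (4 - 3 * s\<^sup>2)"
    by (simp add: D_def power2_eq_square algebra_simps)
  also have "\<dots> = (4 - 3 * s\<^sup>2) - q\<^sup>2 * (4 - 3 * s\<^sup>2)"
    unfolding p2 by (simp add: power2_eq_square algebra_simps)
  also have "\<dots> = 4 * (1 - s\<^sup>2) ^ 3"
    unfolding q2 by (simp add: power2_eq_square power3_eq_cube algebra_simps)
  finally have key: "(1 - p) * D = (1 - s\<^sup>2) ^ 3"
    by simp
  define \<kappa> where "\<kappa> = 1 - 1 / sqrt (2::real)"
  have \<kappa>: "0 \<le> \<kappa>"
    by (simp add: \<kappa>_def)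
  \<comment> \<open>A difference of squares, so \<open>\<kappa>\<close> is the constant that matches
    the lower bound \<open>1 / sqrt 2\<close> for \<open>p\<close>.\<close>
  have "1 / 2 = \<kappa> * (1 + 1 / sqrt 2)"
    by (simp add: \<kappa>_def field_simps)
  also have "\<dots> \<le> \<kappa> * (1 + p)"
    using pge \<kappa> by (intro mult_left_mono) auto
  finally have \<kappa>p: "1 / 2 \<le> \<kappa> * (1 + p)" .
  \<comment> \<open>Uses \<open>4 * (1 - s\<^sup>2) \<le> 4 - 3 * s\<^sup>2\<close>. The factors
    \<open>1 / 2\<close> and \<open>(1 + s) / 2\<close> are then bounded by
    \<open>\<kappa> * (1 + p)\<close> and \<open>p\<^sup>2\<close>.\<close>
  have "(1 - s\<^sup>2) * (1 + s) \<le> (1 / 2) * ((1 + s) / 2) * (4 - 3 * s\<^sup>2)"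
    using s by (simp add: field_simps power2_eq_square)
  also have "\<dots> \<le> (\<kappa> * (1 + p)) * p\<^sup>2 * (4 - 3 * s\<^sup>2)"
    using \<kappa>p p2 qs s s2 by (intro mult_right_mono mult_mono) auto
  also have "\<dots> = \<kappa> * D"
    by (simp add: D_def)
  \<comment> \<open>The cube \<open>(1 - s\<^sup>2) ^ 3\<close> is split so that its first part is
    the desired bound up to \<open>\<kappa>\<close>; the positive \<open>D\<close> cancels at the
    end.\<close>
  finally have "((1 - s\<^sup>2) * (1 - s)) * ((1 - s\<^sup>2) * (1 + s)) \<le> ((1 - s\<^sup>2) * (1 - s)) * (\<kappa> * D)"
    using s s2 by (intro mult_left_mono) auto
  moreover have "((1 - s\<^sup>2) * (1 - s)) * ((1 - s\<^sup>2) * (1 + s)) = (1 - p) * D"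
    unfolding key by (simp add: power2_eq_square power3_eq_cube algebra_simps)
  ultimately have "(1 - p) * D \<le> (\<kappa> * (1 - s\<^sup>2) * (1 - s)) * D"
    by (simp add: mult_ac)
  then show "1 - r_fun (sqrt (1 - s\<^sup>2)) \<le> (1 - 1 / sqrt 2) * (1 - s\<^sup>2) * (1 - s)"
    using D by (simp add: p_def \<kappa>_def)
qed

section \<open>The joint error of both factors\<close>

lemma norm_diff_unit_pairs:
  fixes x u :: "'a::real_inner" and y v :: "'b::real_inner"
  assumes "norm x = 1" "norm u = 1" "norm y = 1" "norm v = 1"
  shows "norm ((x, y) - (u, v)) = sqrt (2 * (2 - u \<bullet> x - v \<bullet> y))"
proof -
  have "x \<bullet> x = 1" "u \<bullet> u = 1" "y \<bullet> y = 1" "v \<bullet> v = 1"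
    using assms by (simp_all add: dot_square_norm)
  then show ?thesis
    by (simp add: norm_Pair power2_norm_eq_inner inner_diff_left inner_diff_right inner_commute)
qed

text \<open>Replacing each squared error by the larger one gives both one-factor bounds the same
  coefficient, so that their sum is a multiple of \<open>2 - s - t\<close>, half of the old squared
  distance.\<close>

lemma sum_one_minus_r_fun_le:
  assumes s: "0 < s" "s \<le> 1" "0 < t" "t \<le> 1"
  shows "2 - r_fun (sqrt (1 - s\<^sup>2)) - r_fun (sqrt (1 - t\<^sup>2))
    \<le> (1 - 1 / sqrt 2) * (max (sqrt (1 - s\<^sup>2)) (sqrt (1 - t\<^sup>2)))\<^sup>2 * (2 - s - t)"
proof -
  define M where "M = (max (sqrt (1 - s\<^sup>2)) (sqrt (1 - t\<^sup>2)))\<^sup>2"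
  have "0 \<le> 1 - s\<^sup>2" "0 \<le> 1 - t\<^sup>2"
    using s by (simp_all add: power_le_one)
  then have M: "1 - s\<^sup>2 \<le> M" "1 - t\<^sup>2 \<le> M"
    by (auto simp: M_def max_def not_le)
  have "(1 - 1 / sqrt 2) * (1 - s\<^sup>2) * (1 - s) \<le> (1 - 1 / sqrt 2) * M * (1 - s)"
    using M s by (intro mult_right_mono mult_left_mono) auto
  moreover have "(1 - 1 / sqrt 2) * (1 - t\<^sup>2) * (1 - t) \<le> (1 - 1 / sqrt 2) * M * (1 - t)"
    using M s by (intro mult_right_mono mult_left_mono) auto
  moreover have "(1 - 1 / sqrt 2) * M * (2 - s - t) =
      (1 - 1 / sqrt 2) * M * (1 - s) + (1 - 1 / sqrt 2) * M * (1 - t)"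
    by (simp flip: distrib_left)
  ultimately show ?thesis
    using one_minus_r_fun_le[OF s(1,2)] one_minus_r_fun_le[OF s(3,4)]
    unfolding M_def[symmetric] by linarith
qed

section \<open>The iterates: invariants, contraction and convergence\<close>

theorem theorem1:
  fixes X :: "real ^ 'n ^ 'm"
    and u u\<^sub>1 :: "real ^ 'm" and v v\<^sub>1 :: "real ^ 'n"
    and \<sigma> :: real
    and U :: "nat \<Rightarrow> real ^ 'm" and V :: "nat \<Rightarrow> real ^ 'n"
    and \<alpha> \<beta> \<epsilon> \<delta> :: "nat \<Rightarrow> real"
  assumes X: "X = \<sigma> *\<^sub>R outer u v"
    and "\<sigma> > 0" and "norm u = 1" and "norm v = 1"
    and "norm u\<^sub>1 = 1" and "norm v\<^sub>1 = 1"
    and "u \<bullet> u\<^sub>1 > 0" and "v \<bullet> v\<^sub>1 > 0"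
    and init: "U 1 = u\<^sub>1" "V 1 = v\<^sub>1"
    and step: "\<And>t. t \<ge> 1 \<Longrightarrow> (U (t + 1), V (t + 1)) = r2rils_step X (U t, V t)"
    and \<alpha>: "\<And>t. \<alpha> t = u \<bullet> U t" and \<beta>: "\<And>t. \<beta> t = v \<bullet> V t"
    and \<epsilon>: "\<And>t. \<epsilon> t = sqrt (1 - (\<alpha> t)\<^sup>2)" and \<delta>: "\<And>t. \<delta> t = sqrt (1 - (\<beta> t)\<^sup>2)"
  shows "(\<lambda>t. (U t, V t)) \<longlonglongrightarrow> (u, v) \<and>
         (\<exists>c. 0 \<le> c \<and> c < sqrt (1 - 1 / sqrt 2) \<and>
           (\<forall>t\<ge>1. norm ((U (t + 1), V (t + 1)) - (u, v)) \<le> c * norm ((U t, V t) - (u, v)))) \<and>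
         \<bar>sqrt (1 - 1 / sqrt 2) - 0.54\<bar> < 0.005 \<and>
         (\<forall>t\<ge>1. (\<epsilon> t, \<delta> t) \<noteq> (0, 0) \<longrightarrow>
           norm ((U (t + 1), V (t + 1)) - (u, v))
             = R_fun (\<epsilon> t) (\<delta> t) * norm ((U t, V t) - (u, v)) \<and>
           R_fun (\<epsilon> t) (\<delta> t) \<le> sqrt (1 - 1 / sqrt 2) * max (\<epsilon> t) (\<delta> t))"
proof -
  define \<kappa> where "\<kappa> = sqrt (1 - 1 / sqrt 2)"
  have \<kappa>: "0 < \<kappa>" "\<kappa>\<^sup>2 = 1 - 1 / sqrt 2" "\<kappa> \<le> 1"
    by (simp_all add: \<kappa>_def)
  have next_UV: "U (t + 1) = sgn (U t + sgn (u - ((u \<bullet> U t) / 2) *\<^sub>R U t))"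
      "V (t + 1) = sgn (V t + sgn (v - ((v \<bullet> V t) / 2) *\<^sub>R V t))"
    if "t \<ge> 1" "norm (U t) = 1" "norm (V t) = 1" "0 < u \<bullet> U t" "0 < v \<bullet> V t" for t
    using step[OF \<open>t \<ge> 1\<close>] r2rils_step_outer[OF that(2,3) \<open>\<sigma> > 0\<close> that(4,5)] by (simp_all add: X)
  \<comment> \<open>The closed form of a step needs unit vectors with positive overlaps, so these
    facts are carried together; positivity persists because the new overlaps are values of
    \<open>r_fun\<close>.\<close>
  have inv: "norm (U t) = 1 \<and> norm (V t) = 1 \<and> 0 < \<alpha> t \<and> 0 < \<beta> t" if "t \<ge> 1" for t
    using that
  proof (induction t rule: dec_induct)
    case base
    then show ?case
      using assms by simp
  next
    case (step t)
    then show ?case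
      using next_UV[of t] norm_update[of u "U t"] norm_update[of v "V t"]
        inner_update[of u "U t"] inner_update[of v "V t"] assms(3,4)
      by (simp add: \<alpha> \<beta> r_fun_pos inner_le_1)
  qed
  have unit: "norm (U t) = 1" "norm (V t) = 1" and pos: "0 < \<alpha> t" "0 < \<beta> t"
    and le: "\<alpha> t \<le> 1" "\<beta> t \<le> 1" if "t \<ge> 1" for t
    using inv[OF that] assms(3,4) by (simp_all add: \<alpha> \<beta> inner_le_1)
  have r: "\<alpha> (t + 1) = r_fun (\<epsilon> t)" "\<beta> (t + 1) = r_fun (\<delta> t)" if "t \<ge> 1" for t
    using next_UV[OF that] inv[OF that] inner_update[of u "U t"] inner_update[of v "V t"] assms(3,4)
    by (simp_all add: \<alpha> \<beta> \<epsilon> \<delta>)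
  define N where "N t = norm ((U t, V t) - (u, v))" for t
  have N: "N t = sqrt (2 * (2 - \<alpha> t - \<beta> t))" if "t \<ge> 1" for t
    using norm_diff_unit_pairs[of "U t" u "V t" v] unit[OF that] assms(3,4)
    by (simp add: N_def \<alpha> \<beta>)
  have \<epsilon>0: "0 \<le> \<epsilon> t" "0 \<le> \<delta> t" and sq: "sqrt (1 - (\<epsilon> t)\<^sup>2) = \<alpha> t" "sqrt (1 - (\<delta> t)\<^sup>2) = \<beta> t"
    if "t \<ge> 1" for t
    using pos[OF that] le[OF that] by (simp_all add: \<epsilon> \<delta> power_le_one)
  have main: "2 - r_fun (\<epsilon> t) - r_fun (\<delta> t) \<le> (\<kappa> * max (\<epsilon> t) (\<delta> t))\<^sup>2 * (2 - \<alpha> t - \<beta> t)"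
    if "t \<ge> 1" for t
    using sum_one_minus_r_fun_le[OF pos(1) le(1) pos(2) le(2), OF that that that that]
    by (simp add: \<epsilon> \<delta> power_mult_distrib \<kappa>(2))
  \<comment> \<open>Stated without the quotient \<open>R_fun\<close>, so that it also covers the
    case of zero error.\<close>
  have N_le: "N (t + 1) \<le> \<kappa> * max (\<epsilon> t) (\<delta> t) * N t" if "t \<ge> 1" for t
  proof -
    have "N (t + 1) = sqrt (2 * (2 - r_fun (\<epsilon> t) - r_fun (\<delta> t)))"
      using N[of "t + 1"] that r[OF that] by simp
    also have "\<dots> \<le> sqrt ((\<kappa> * max (\<epsilon> t) (\<delta> t))\<^sup>2 * (2 * (2 - \<alpha> t - \<beta> t)))"
      using main[OF that] by (simp only: real_sqrt_le_iff mult.left_commute[of _ 2]) simp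
    also have "\<dots> = \<kappa> * max (\<epsilon> t) (\<delta> t) * N t"
      using \<epsilon>0[OF that] \<kappa>(1) by (simp add: real_sqrt_mult[of "_\<^sup>2"] N[OF that] le_max_iff_disj)
    finally show ?thesis .
  qed
  \<comment> \<open>Overlaps never decrease, so the errors never exceed their initial values; this
    gives a contraction factor uniform in \<open>t\<close>.\<close>
  have mono: "s \<le> r_fun (sqrt (1 - s\<^sup>2))" if "0 < s" "s \<le> 1" for s
  proof -
    have "(1 - 1 / sqrt 2) * (1 - s\<^sup>2) \<le> 1"
      using that by (intro mult_le_one) (auto simp: power_le_one)
    then have "(1 - 1 / sqrt 2) * (1 - s\<^sup>2) * (1 - s) \<le> 1 * (1 - s)"
      using that by (intro mult_right_mono) auto
    with one_minus_r_fun_le[OF that] show ?thesis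
      by simp
  qed
  have ge: "\<alpha> 1 \<le> \<alpha> t \<and> \<beta> 1 \<le> \<beta> t" if "t \<ge> 1" for t
    using that
  proof (induction t rule: dec_induct)
    case base
    then show ?case by simp
  next
    case (step t)
    then show ?case
      using r[of t] mono[OF pos(1) le(1), of t] mono[OF pos(2) le(2), of t]
      by (simp add: \<epsilon> \<delta>)
  qed
  \<comment> \<open>Positive initial overlaps force \<open>\<epsilon> 1\<close> and
    \<open>\<delta> 1\<close> below 1, which keeps \<open>c\<close> strictly below
    \<open>\<kappa>\<close>.\<close>
  define c where "c = \<kappa> * max (\<epsilon> 1) (\<delta> 1)"
  have c0: "0 \<le> c"
    using \<kappa>(1) \<epsilon>0[of 1] by (simp add: c_def le_max_iff_disj)
  have "max (\<epsilon> 1) (\<delta> 1) < 1"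
    using pos[of 1] by (simp add: \<epsilon> \<delta>)
  then have c\<kappa>: "c < \<kappa>"
    using \<kappa>(1) by (simp add: c_def)
  have contr: "N (t + 1) \<le> c * N t" if "t \<ge> 1" for t
  proof -
    have "\<epsilon> t \<le> \<epsilon> 1" "\<delta> t \<le> \<delta> 1"
      using ge[OF that] pos[of 1] by (auto simp: \<epsilon> \<delta> intro!: power_mono)
    then have "max (\<epsilon> t) (\<delta> t) \<le> max (\<epsilon> 1) (\<delta> 1)"
      by (rule max.mono)
    then have "\<kappa> * max (\<epsilon> t) (\<delta> t) * N t \<le> c * N t"
      unfolding c_def using \<kappa>(1) by (intro mult_right_mono mult_left_mono) (auto simp: N_def)
    with N_le[OF that] show ?thesis by simp
  qed
  \<comment> \<open>The recursion governs the sequence only from index 1 on, hence the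
    shift.\<close>
  have geom: "N (Suc t) \<le> c ^ t * N 1" for t
  proof (induction t)
    case (Suc t)
    have "N (Suc (Suc t)) \<le> c * N (Suc t)"
      using contr[of "Suc t"] by simp
    also have "\<dots> \<le> c * (c ^ t * N 1)"
      using Suc c0 by (intro mult_left_mono) auto
    finally show ?case by (simp add: mult_ac)
  qed simp
  have "(\<lambda>t. c ^ t * N 1) \<longlonglongrightarrow> 0"
    using c0 c\<kappa> \<kappa>(3) by (intro tendsto_mult_left_zero LIMSEQ_power_zero) auto
  then have "(\<lambda>t. N (Suc t)) \<longlonglongrightarrow> 0"
    by (rule Lim_null_comparison[rotated]) (use geom in \<open>auto simp: N_def\<close>)
  then have "N \<longlonglongrightarrow> 0"
    by (rule LIMSEQ_imp_Suc)
  then have conv: "(\<lambda>t. (U t, V t)) \<longlonglongrightarrow> (u, v)"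
    unfolding N_def tendsto_norm_zero_iff by (rule LIM_zero_cancel)
  \<comment> \<open>These bounds are tight enough to place \<open>1 - 1 / sqrt 2\<close> between the
    squares of 0.535 and 0.545.\<close>
  have "141 / 100 < sqrt (2::real)" "sqrt 2 < (142 / 100 :: real)"
    by (rule real_less_rsqrt real_less_lsqrt; simp add: power2_eq_square)+
  then have "(535 / 1000)\<^sup>2 < 1 - 1 / sqrt 2" "1 - 1 / sqrt 2 < (545 / 1000 :: real)\<^sup>2"
    by (simp_all add: field_simps power2_eq_square)
  then have num: "\<bar>\<kappa> - 0.54\<bar> < 0.005"
    using real_less_rsqrt[of "535 / 1000" "1 - 1 / sqrt 2"]
      real_less_lsqrt[of "545 / 1000" "1 - 1 / sqrt 2"]
    by (simp add: \<kappa>_def abs_if)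
  have R: "N (t + 1) = R_fun (\<epsilon> t) (\<delta> t) * N t \<and> R_fun (\<epsilon> t) (\<delta> t) \<le> \<kappa> * max (\<epsilon> t) (\<delta> t)"
    if t: "t \<ge> 1" and nz: "(\<epsilon> t, \<delta> t) \<noteq> (0, 0)" for t
  proof -
    \<comment> \<open>Some overlap is below 1, so the quotient in \<open>R_fun\<close> has a
      positive denominator, which cancels against the same factor in \<open>N t\<close>.\<close>
    have "\<alpha> t \<noteq> 1 \<or> \<beta> t \<noteq> 1"
      using nz by (auto simp: \<epsilon> \<delta>)
    then have D: "0 < 2 - \<alpha> t - \<beta> t"
      using le[OF t] by auto
    have R_eq: "R_fun (\<epsilon> t) (\<delta> t) = sqrt ((2 - \<alpha> (t + 1) - \<beta> (t + 1)) / (2 - \<alpha> t - \<beta> t))"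
      by (simp only: R_fun_def sq[OF t] r[OF t])
    have "N (t + 1) = R_fun (\<epsilon> t) (\<delta> t) * N t"
      unfolding R_eq N[OF t] N[OF trans_le_add1[OF t]] real_sqrt_mult real_sqrt_divide
      using D by simp
    moreover have "R_fun (\<epsilon> t) (\<delta> t) \<le> sqrt ((\<kappa> * max (\<epsilon> t) (\<delta> t))\<^sup>2)"
      unfolding R_eq r[OF t] real_sqrt_le_iff using main[OF t] D by (simp add: pos_divide_le_eq)
    then have "R_fun (\<epsilon> t) (\<delta> t) \<le> \<kappa> * max (\<epsilon> t) (\<delta> t)"
      using \<epsilon>0[OF t] \<kappa>(1) by (simp add: le_max_iff_disj)
    ultimately show ?thesis by blast
  qed
  show ?thesis
    using conv c0 c\<kappa> contr num R unfolding N_def \<kappa>_def by blast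
qed

end
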